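(* Let $t\geq 3$ be an integer. Every $3$-dimensional grid is equitably $(t,\mathcal{D}_1)$-choosable. Moreover, there is an algorithm which, for every $3$-dimensional grid $G$ and every $t$-uniform list assignment $L$ for $G$, returns an equitable $(L,\mathcal{D}_1)$-colouring of $G$ in time polynomial in $|V(G)|$.
   Context: A $3$-dimensional grid is a Cartesian product $P_{n_1}\square P_{n_2}\square P_{n_3}$ of three paths, each on at least two vertices; here $G_1\square G_2$ has vertex set $V(G_1)\times V(G_2)$, with $(x_1,y_1)(x_2,y_2)$ an edge iff either $x_1=x_2$ and $y_1y_2\in E(G_2)$, or $y_1=y_2$ and $x_1x_2\in E(G_1)$. $\mathcal{D}_1$ is the class of forests ($1$-degenerate graphs: every subgraph has minimum degree at most $1$). A list assignment $L$ assigns a nonempty subset $L(v)\subseteq\mathbb{N}$ to each vertex; it is $t$-uniform if $|L(v)|=t$ for all $v$. An $(L,\mathcal{D}_1)$-colouring is a map $c$ with $c(v)\in L(v)$ for all $v$ such that each colour class induces a forest; it is equitable if each colour class has at most $\lceil |V(G)|/t\rceil$ vertices. $G$ is equitably $(t,\mathcal{D}_1)$-choosable if for every $t$-uniform list assignment $L$ there is an equitable $(L,\mathcal{D}_1)$-colouring of $G$. *)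

theory Defs
  imports Complex_Main "HOL-Computational_Algebra.Polynomial"
begin

section \<open>Graphs\<close>

text \<open>The graphs are simple: an edge is the set of its two ends.\<close>

record 'a graph =
  verts :: "'a set"
  edges :: "'a set set"

definition subgraph :: "'a graph \<Rightarrow> 'a graph \<Rightarrow> bool" where
  "subgraph H G \<longleftrightarrow>
     verts H \<subseteq> verts G \<and> edges H \<subseteq> edges G \<and> (\<forall>e\<in>edges H. e \<subseteq> verts H)"

definition induced :: "'a graph \<Rightarrow> 'a set \<Rightarrow> 'a graph" where
  "induced G S = \<lparr>verts = verts G \<inter> S, edges = {e \<in> edges G. e \<subseteq> S}\<rparr>"

definition vertex_degree :: "'a graph \<Rightarrow> 'a \<Rightarrow> nat" where
  "vertex_degree G v = card {e \<in> edges G. v \<in> e}"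

definition min_degree :: "'a graph \<Rightarrow> nat" where
  "min_degree G = Min (vertex_degree G ` verts G)"

text \<open>\<open>degenerate 1\<close> is the class of forests. The graph without vertices, for which the
  minimum degree is undefined, is \<open>k\<close>-degenerate.\<close>

definition degenerate :: "nat \<Rightarrow> 'a graph \<Rightarrow> bool" where
  "degenerate k G \<longleftrightarrow> (\<forall>H. subgraph H G \<and> verts H \<noteq> {} \<longrightarrow> min_degree H \<le> k)"

definition path_graph :: "nat \<Rightarrow> nat graph" where
  "path_graph n = \<lparr>verts = {0..<n}, edges = {{i, Suc i} | i. Suc i < n}\<rparr>"

definition cart_prod :: "'a graph \<Rightarrow> 'b graph \<Rightarrow> ('a \<times> 'b) graph" where
  "cart_prod G H =
     \<lparr>verts = verts G \<times> verts H,
      edges = {{(x1, y1), (x2, y2)} | x1 y1 x2 y2.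
                 x1 = x2 \<and> x1 \<in> verts G \<and> {y1, y2} \<in> edges H \<or>
                 y1 = y2 \<and> y1 \<in> verts H \<and> {x1, x2} \<in> edges G}\<rparr>"

type_synonym vertex3 = "(nat \<times> nat) \<times> nat"

definition grid3 :: "nat \<Rightarrow> nat \<Rightarrow> nat \<Rightarrow> vertex3 graph" where
  "grid3 n1 n2 n3 = cart_prod (cart_prod (path_graph n1) (path_graph n2)) (path_graph n3)"


section \<open>Equitable list colourings\<close>

definition list_assignment :: "'a graph \<Rightarrow> ('a \<Rightarrow> nat set) \<Rightarrow> bool" where
  "list_assignment G L \<longleftrightarrow> (\<forall>v\<in>verts G. L v \<noteq> {})"

definition uniform :: "nat \<Rightarrow> 'a graph \<Rightarrow> ('a \<Rightarrow> nat set) \<Rightarrow> bool" where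
  "uniform t G L \<longleftrightarrow> (\<forall>v\<in>verts G. finite (L v) \<and> card (L v) = t)"

definition colour_class :: "'a graph \<Rightarrow> ('a \<Rightarrow> nat) \<Rightarrow> nat \<Rightarrow> 'a set" where
  "colour_class G c k = {v \<in> verts G. c v = k}"

definition list_colouring ::
    "('a graph \<Rightarrow> bool) \<Rightarrow> 'a graph \<Rightarrow> ('a \<Rightarrow> nat set) \<Rightarrow> ('a \<Rightarrow> nat) \<Rightarrow> bool" where
  "list_colouring \<D> G L c \<longleftrightarrow>
     (\<forall>v\<in>verts G. c v \<in> L v) \<and> (\<forall>k. \<D> (induced G (colour_class G c k)))"

definition equitable :: "nat \<Rightarrow> 'a graph \<Rightarrow> ('a \<Rightarrow> nat) \<Rightarrow> bool" where
  "equitable t G c \<longleftrightarrow>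
     (\<forall>k. int (card (colour_class G c k)) \<le> \<lceil>real (card (verts G)) / real t\<rceil>)"

definition equitably_choosable :: "nat \<Rightarrow> ('a graph \<Rightarrow> bool) \<Rightarrow> 'a graph \<Rightarrow> bool" where
  "equitably_choosable t \<D> G \<longleftrightarrow>
     (\<forall>L. list_assignment G L \<and> uniform t G L \<longrightarrow>
        (\<exists>c. list_colouring \<D> G L c \<and> equitable t G c))"


section \<open>Algorithms and running time\<close>

text \<open>
  The model of computation is the unit-cost random access machine, programmed in a structured
  language. The memory consists of unbounded arrays of natural numbers. Array names are constants
  of the program, so a program uses only finitely many arrays; indices are computed. The arithmetic
  operations are addition and truncated subtraction; multiplication is not an operation, since at
  unit cost it would go beyond polynomial time on Turing machines. Every assignment and every test costs one step
  (the size of the expressions in it is bounded by a constant of the program). At unit cost a colour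
  is a single memory word, so a running time can be bounded in terms of \<open>|V(G)|\<close> alone, however
  large the colours in the lists are.
\<close>

type_synonym store = "nat \<Rightarrow> nat \<Rightarrow> nat"

datatype expr = Num nat | Get nat expr | Add expr expr | Sub expr expr

datatype test = Less expr expr | Equal expr expr | Neg test | Conj test test

datatype prog =
    Skip
  | Assign nat expr expr
  | Seq prog prog
  | Cond test prog prog
  | While test prog

primrec val :: "expr \<Rightarrow> store \<Rightarrow> nat" where
  "val (Num n) s = n"
| "val (Get a e) s = s a (val e s)"
| "val (Add e f) s = val e s + val f s"
| "val (Sub e f) s = val e s - val f s"

primrec holds :: "test \<Rightarrow> store \<Rightarrow> bool" where
  "holds (Less e f) s \<longleftrightarrow> val e s < val f s"
| "holds (Equal e f) s \<longleftrightarrow> val e s = val f s"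
| "holds (Neg b) s \<longleftrightarrow> \<not> holds b s"
| "holds (Conj b d) s \<longleftrightarrow> holds b s \<and> holds d s"

text \<open>\<open>exec P s n s'\<close>: started in \<open>s\<close>, the program \<open>P\<close> halts in \<open>s'\<close> after \<open>n\<close> steps.\<close>

inductive exec :: "prog \<Rightarrow> store \<Rightarrow> nat \<Rightarrow> store \<Rightarrow> bool" where
  exec_Skip: "exec Skip s 1 s"
| exec_Assign: "exec (Assign a i e) s 1 (s(a := (s a)(val i s := val e s)))"
| exec_Seq: "exec P s m s' \<Longrightarrow> exec Q s' n s'' \<Longrightarrow> exec (Seq P Q) s (m + n) s''"
| exec_Cond_True: "holds b s \<Longrightarrow> exec P s n s' \<Longrightarrow> exec (Cond b P Q) s (Suc n) s'"
| exec_Cond_False: "\<not> holds b s \<Longrightarrow> exec Q s n s' \<Longrightarrow> exec (Cond b P Q) s (Suc n) s'"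
| exec_While_False: "\<not> holds b s \<Longrightarrow> exec (While b P) s 1 s"
| exec_While_True:
    "holds b s \<Longrightarrow> exec P s m s' \<Longrightarrow> exec (While b P) s' n s'' \<Longrightarrow>
       exec (While b P) s (Suc (m + n)) s''"

inductive_cases exec_SkipE: "exec Skip s n s'"
inductive_cases exec_AssignE: "exec (Assign a i e) s n s'"
inductive_cases exec_SeqE: "exec (Seq P Q) s n s'"
inductive_cases exec_CondE: "exec (Cond b P Q) s n s'"
inductive_cases exec_WhileE: "exec (While b P) s n s'"

lemma exec_deterministic:
  "exec P s m s' \<Longrightarrow> exec P s n s'' \<Longrightarrow> n = m \<and> s'' = s'"
proof (induction arbitrary: n s'' rule: exec.induct)
  case exec_Skip
  then show ?case by (auto elim: exec_SkipE)
next
  case exec_Assign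
  then show ?case by (auto elim: exec_AssignE)
next
  case exec_Seq
  from exec_Seq.prems show ?case by (rule exec_SeqE) (use exec_Seq.IH in blast)
next
  case exec_Cond_True
  from exec_Cond_True.prems show ?case by (rule exec_CondE) (use exec_Cond_True in blast)+
next
  case exec_Cond_False
  from exec_Cond_False.prems show ?case by (rule exec_CondE) (use exec_Cond_False in blast)+
next
  case exec_While_False
  from exec_While_False.prems show ?case by (rule exec_WhileE) (use exec_While_False in auto)
next
  case exec_While_True
  from exec_While_True.prems show ?case by (rule exec_WhileE) (use exec_While_True in blast)+
qed

text \<open>
  Vertices are numbered lexicographically. The input is the grid, given by its three dimensions in
  array 0, and the lists, written one after the other into array 1, the \<open>t\<close> elements of each list
  in arbitrary order; all other memory cells are 0. The colour chosen for the vertex number \<open>i\<close> is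
  returned in cell \<open>i\<close> of array 2.
\<close>

fun vertex_index :: "nat \<Rightarrow> nat \<Rightarrow> vertex3 \<Rightarrow> nat" where
  "vertex_index n2 n3 ((x, y), z) = (x * n2 + y) * n3 + z"

definition is_input ::
    "nat \<Rightarrow> nat \<Rightarrow> nat \<Rightarrow> nat \<Rightarrow> (vertex3 \<Rightarrow> nat set) \<Rightarrow> store \<Rightarrow> bool" where
  "is_input t n1 n2 n3 L s \<longleftrightarrow>
     s 0 0 = n1 \<and> s 0 1 = n2 \<and> s 0 2 = n3 \<and> (\<forall>i\<ge>3. s 0 i = 0) \<and>
     (\<forall>v\<in>verts (grid3 n1 n2 n3).
        (\<lambda>j. s 1 (vertex_index n2 n3 v * t + j)) ` {0..<t} = L v) \<and>
     (\<forall>i \<ge> card (verts (grid3 n1 n2 n3)) * t. s 1 i = 0) \<and>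
     (\<forall>a\<ge>2. \<forall>i. s a i = 0)"

definition output_colouring :: "nat \<Rightarrow> nat \<Rightarrow> store \<Rightarrow> vertex3 \<Rightarrow> nat" where
  "output_colouring n2 n3 s v = s 2 (vertex_index n2 n3 v)"

end

theory Submission
  imports Defs
begin

text \<open>
  Number the vertices of the grid lexicographically. Neighbours then have numbers that differ by
  1, \<open>a = n3\<close> or \<open>b = n2 * n3\<close>, so it is enough to colour the graph on \<open>{..<N}\<close> in which all such
  pairs are adjacent. Remove the vertices in blocks of \<open>t\<close>: always take the least remaining vertex,
  except that the third vertex of a block is \<open>x + a\<close>, if that remains, where \<open>x\<close> is the first
  vertex of the block. Then the vertex in position \<open>j\<close> (counted from 0) of its block has at most
  \<open>2 * j + 1\<close> neighbours that are removed in later blocks.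

  Colour in the reverse order, and let every vertex already coloured weigh 2 for its colour if it
  lies in the block of the current vertex, and 1 if it is a neighbour in another block. The total
  weight is at most \<open>2 * (t - 1 - j) + (2 * j + 1) < 2 * t\<close>, so one of the \<open>t\<close> colours in the
  list has weight at most 1. Choosing it keeps the colours within a block distinct, which bounds
  the colour classes by the number of blocks, and gives each vertex at most one later neighbour of its own colour, which makes
  the colour classes forests.
\<close>

section \<open>The order of removal\<close>

text \<open>This contains the grid, but also pairs that wrap round the end of a row or a layer.
  Treating them as adjacent removes all boundary cases.\<close>

definition adj :: "nat \<Rightarrow> nat \<Rightarrow> nat \<Rightarrow> nat \<Rightarrow> bool" where
  "adj a b u v \<longleftrightarrow> u = v + 1 \<or> v = u + 1 \<or> u = v + a \<or> v = u + a \<or> u = v + b \<or> v = u + b"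

definition remaining :: "nat \<Rightarrow> (nat \<Rightarrow> nat) \<Rightarrow> nat \<Rightarrow> nat set" where
  "remaining N f k = {..<N} - f ` {..<k}"

definition peel_step :: "nat \<Rightarrow> nat \<Rightarrow> nat \<Rightarrow> (nat \<Rightarrow> nat) \<Rightarrow> nat \<Rightarrow> nat" where
  "peel_step N a t f k =
     (if k mod t = 2 \<and> f (k - 2) + a \<in> remaining N f k then f (k - 2) + a
      else Min (remaining N f k))"

text \<open>A recursion stated as a property: \<open>peel_step\<close> reads \<open>f\<close> only
  below \<open>k\<close>. So the contents of an array can be shown to satisfy it, and the values
  from \<open>N\<close> on stay free.\<close>

definition peeling :: "nat \<Rightarrow> nat \<Rightarrow> nat \<Rightarrow> (nat \<Rightarrow> nat) \<Rightarrow> bool" where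
  "peeling N a t f \<longleftrightarrow> (\<forall>k<N. f k = peel_step N a t f k)"

lemma finite_remaining [simp]: "finite (remaining N f k)"
  by (simp add: remaining_def)

lemma remaining_nonempty:
  assumes "k < N" shows "remaining N f k \<noteq> {}"
proof
  assume "remaining N f k = {}"
  then have "{..<N} \<subseteq> f ` {..<k}" by (auto simp: remaining_def)
  then have "card {..<N} \<le> card (f ` {..<k})" by (intro card_mono) auto
  also have "\<dots> \<le> k" using card_image_le[of "{..<k}" f] by simp
  finally show False using assms by simp
qed

lemma peel_step_cong:
  assumes "\<And>i. i < k \<Longrightarrow> f i = g i"
  shows "peel_step N a t f k = peel_step N a t g k"
proof -
  have "f ` {..<k} = g ` {..<k}" using assms by (auto intro!: image_cong)
  moreover have "f (k - 2) = g (k - 2)" if "k mod t = 2"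
  proof -
    \<comment> \<open>Then \<open>k - 2 < k\<close> holds also under truncated subtraction.\<close>
    have "k > 0" using that by (cases k) auto
    then show ?thesis using assms[of "k - 2"] by simp
  qed
  ultimately show ?thesis by (auto simp: peel_step_def remaining_def)
qed

lemma peel_step_in_remaining:
  assumes "k < N" shows "peel_step N a t f k \<in> remaining N f k"
  using Min_in[OF finite_remaining remaining_nonempty[OF assms]]
  by (auto simp: peel_step_def)

section \<open>Weights and loads with respect to a fixed order\<close>

context
  fixes N a b t :: nat and f :: "nat \<Rightarrow> nat"
begin

definition outer :: "nat \<Rightarrow> nat set" where
  "outer k = {k' \<in> {k<..<N}. k' div t \<noteq> k div t \<and> adj a b (f k) (f k')}"

definition weight :: "nat \<Rightarrow> nat \<Rightarrow> nat" where
  "weight k k' = (if k' div t = k div t then 2 else if adj a b (f k) (f k') then 1 else 0)"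

text \<open>Only positions after \<open>k\<close> count, so colouring towards smaller positions
  never changes the load at a position already treated.\<close>

definition load :: "(nat \<Rightarrow> nat) \<Rightarrow> nat \<Rightarrow> nat \<Rightarrow> nat" where
  "load c k q = (\<Sum>k'\<in>{k<..<N}. if c (f k') = q then weight k k' else 0)"

definition light_colouring :: "(nat \<Rightarrow> nat) \<Rightarrow> bool" where
  "light_colouring c \<longleftrightarrow> (\<forall>k<N. load c k (c (f k)) < 2)"

context
  assumes t: "t \<ge> 3" and f: "peeling N a t f"
begin

lemma peeling_step: "k < N \<Longrightarrow> f k = peel_step N a t f k"
  using f by (simp add: peeling_def)

lemma peeling_in_remaining: "k < N \<Longrightarrow> f k \<in> remaining N f k"
  using peel_step_in_remaining peeling_step by metis

lemma peeling_inj: "inj_on f {..<N}"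
proof (rule linorder_inj_onI)
  fix i j assume "i < j" "i \<in> {..<N}" "j \<in> {..<N}"
  then have "f j \<notin> f ` {..<j}" "f i \<in> f ` {..<j}"
    using peeling_in_remaining[of j] by (auto simp: remaining_def)
  then show "f i \<noteq> f j" by metis
qed auto

lemma peeling_bij: "bij_betw f {..<N} {..<N}"
proof -
  have "f ` {..<N} \<subseteq> {..<N}" using peeling_in_remaining by (auto simp: remaining_def)
  then have "f ` {..<N} = {..<N}" using peeling_inj by (intro endo_inj_surj) auto
  then show ?thesis using peeling_inj by (simp add: bij_betw_def)
qed

section \<open>Neighbours in later blocks\<close>

lemma peeling_later: "i \<le> k \<Longrightarrow> k < N \<Longrightarrow> f k \<in> remaining N f i"
  using peeling_in_remaining[of k] by (force simp: remaining_def)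

text \<open>Without the special rule, \<open>f k\<close> is the minimum of the remaining vertices,
  and \<open>f k'\<close> is among them. The hypothesis compares values: in position 2 of a block, a
  value other than \<open>f (k - 2) + a\<close> can only come from the minimum.\<close>

lemma peeling_Min:
  assumes "k < N" "f k \<noteq> f (k - 2) + a \<or> k mod t \<noteq> 2" "k < k'" "k' < N"
  shows "f k < f k'"
proof -
  have "f k = Min (remaining N f k)"
    using peeling_step[OF assms(1)] assms(2) by (auto simp: peel_step_def split: if_splits)
  moreover have "f k' \<in> remaining N f k" using assms by (intro peeling_later) auto
  ultimately have "f k \<le> f k'" by simp
  moreover have "f k \<noteq> f k'" using assms inj_onD[OF peeling_inj, of k k'] by auto
  ultimately show ?thesis by simp
qed

text \<open>The candidates form a list because some may coincide, for instance if
  \<open>a = b\<close>; only the length matters.\<close>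

lemma card_outer_le:
  assumes "f ` outer k \<subseteq> set us" "length us \<le> m"
  shows "card (outer k) \<le> m"
proof -
  have "inj_on f (outer k)" by (rule inj_on_subset[OF peeling_inj]) (auto simp: outer_def)
  then have "card (outer k) = card (f ` outer k)" by (simp add: card_image)
  also have "\<dots> \<le> card (set us)" using assms by (intro card_mono) auto
  finally show ?thesis using assms card_length[of us] by simp
qed

lemma card_outer_Min:
  assumes "k < N" "f k \<noteq> f (k - 2) + a \<or> k mod t \<noteq> 2"
  shows "card (outer k) \<le> 3"
proof (rule card_outer_le)
  show "f ` outer k \<subseteq> set [f k + 1, f k + a, f k + b]"
    using peeling_Min[OF assms] by (fastforce simp: outer_def adj_def)
qed simp

text \<open>The vertex after \<open>f k\<close> in the block is \<open>f k + 1\<close>, and the next one is \<open>f k + a\<close>, whenever these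
  remain; so only \<open>f k + b\<close> can be a neighbour outside the block.\<close>

lemma card_outer_first:
  assumes "k < N" "k mod t = 0"
  shows "card (outer k) \<le> 1"
proof (rule card_outer_le)
  show "f ` outer k \<subseteq> set [f k + b]"
  proof
    fix u assume "u \<in> f ` outer k"
    then obtain k' where k': "u = f k'" "k < k'" "k' < N" "k' div t \<noteq> k div t" "adj a b (f k) u"
      by (auto simp: outer_def)
    \<comment> \<open>Position \<open>k\<close> starts its block, so another block is reached only
      after \<open>t\<close> positions. As \<open>t\<close> is at least 3, positions
      \<open>k + 1\<close> and \<open>k + 2\<close> come before \<open>k'\<close>.\<close>
    have "k' \<ge> k + t"
    proof (rule ccontr)
      assume "\<not> k + t \<le> k'"
      moreover obtain d where d: "k = t * d" using assms(2) by auto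
      ultimately have "k' div t = d" using k'(2) t
        by (intro div_nat_eqI) (auto simp: algebra_simps)
      then show False using k'(4) d t by simp
    qed
    then have le: "k + 2 < k'" using t by simp
    have lt: "f k < u" using peeling_Min[of k k'] assms k' by simp
    have m1: "(k + 1) mod t = 1" "(k + 2) mod t = 2"
      using assms(2) t mod_add_left_eq[of k t 1, symmetric] mod_add_left_eq[of k t 2, symmetric]
      by (simp_all del: mod_add_left_eq)
    \<comment> \<open>Position \<open>k + 1\<close> also takes a minimum, so its vertex would lie
      strictly between \<open>f k\<close> and \<open>f k + 1\<close>.\<close>
    have "u \<noteq> f k + 1"
    proof
      assume u: "u = f k + 1"
      have "f (k + 1) < u" using peeling_Min[of "k + 1" k'] m1 k' le by simp
      moreover have "f k < f (k + 1)" using peeling_Min[of k "k + 1"] assms k' le by simp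
      ultimately show False using u by simp
    qed
    moreover have "u \<noteq> f k + a"
    proof
      assume u: "u = f k + a"
      have "u \<in> remaining N f (k + 2)" using peeling_later[of "k + 2" k'] k' le by simp
      then have "f (k + 2) = u" using peeling_step[of "k + 2"] m1 u k' le
        by (simp add: peel_step_def)
      then show False using inj_onD[OF peeling_inj, of "k + 2" k'] k' le by simp
    qed
    ultimately show "u \<in> set [f k + b]" using k'(5) lt by (auto simp: adj_def)
  qed
qed auto

text \<open>If \<open>f k\<close> is \<open>f (k - 2) + a\<close>, its neighbour
  \<open>f k - a\<close> is the first vertex of the block and already gone, which leaves five of
  six. Otherwise \<open>f k\<close> is a minimum and only three are left.\<close>

lemma card_outer_third:
  assumes "k < N" "k mod t = 2"
  shows "card (outer k) \<le> 5"
proof (cases "f k = f (k - 2) + a")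
  case True
  have "k \<ge> 2" using assms(2) by (metis mod_less_eq_dividend)
  show ?thesis
  proof (rule card_outer_le)
    show "f ` outer k \<subseteq> set [f k + 1, f k + a, f k + b, f k - 1, f k - b]"
    proof
      fix u assume "u \<in> f ` outer k"
      then obtain k' where k': "u = f k'" "k < k'" "k' < N" "adj a b (f k) u"
        by (auto simp: outer_def)
      have "u \<noteq> f (k - 2)" using inj_onD[OF peeling_inj, of "k - 2" k'] k' \<open>k \<ge> 2\<close> by fastforce
      then show "u \<in> set [f k + 1, f k + a, f k + b, f k - 1, f k - b]"
        using k' True by (auto simp: adj_def)
    qed
  qed simp
next
  case False
  then show ?thesis using card_outer_Min[of k] assms by simp
qed

lemma card_outer_le_6: "card (outer k) \<le> 6"
proof (rule card_outer_le)
  show "f ` outer k \<subseteq> set [f k + 1, f k + a, f k + b, f k - 1, f k - a, f k - b]"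
    by (auto simp: outer_def adj_def)
qed simp

text \<open>The order matters only for the first three positions of a block, with bounds 1, 3 and 5;
  from position 3 on, the bound is at least 7, while there are at most six neighbours.\<close>

lemma card_outer:
  assumes "k < N"
  shows "card (outer k) \<le> 2 * (k mod t) + 1"
proof -
  consider "k mod t = 0" | "k mod t = 1" | "k mod t = 2" | "k mod t \<ge> 3" by linarith
  then show ?thesis
    using card_outer_first[OF assms] card_outer_Min[OF assms] card_outer_third[OF assms]
      card_outer_le_6[of k]
    by cases auto
qed

section \<open>Light colours and their consequences\<close>

lemma sum_weight:
  assumes "k < N"
  shows "(\<Sum>k'\<in>{k<..<N}. weight k k') < 2 * t"
proof -
  define same where "same = {k' \<in> {k<..<N}. k' div t = k div t}"
  \<comment> \<open>The block of \<open>k\<close> ends just before position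
    \<open>k + (t - k mod t)\<close>.\<close>
  have "same \<subseteq> {k<..<k + (t - k mod t)}"
  proof
    fix k' assume k': "k' \<in> same"
    have "k' < Suc (k' div t) * t" using t by (simp add: dividend_less_div_times)
    also have "\<dots> = (k div t) * t + t" using k' by (simp add: same_def)
    finally have "k' + k mod t < k + t" using div_mult_mod_eq[of k t] by linarith
    then show "k' \<in> {k<..<k + (t - k mod t)}" using k' by (simp add: same_def)
  qed
  then have "card same \<le> card {k<..<k + (t - k mod t)}" by (intro card_mono) auto
  also have "\<dots> = t - k mod t - 1" by simp
  finally have same: "card same \<le> t - k mod t - 1" .
  have "(\<Sum>k'\<in>{k<..<N}. weight k k') =
      (\<Sum>k'\<in>{k<..<N}. (if k' \<in> same then 2 else 0) + (if k' \<in> outer k then 1 else 0))"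
    by (intro sum.cong) (auto simp: weight_def same_def outer_def)
  also have "\<dots> = 2 * card ({k<..<N} \<inter> same) + card ({k<..<N} \<inter> outer k)"
    by (simp add: sum.distrib sum.If_cases)
  also have "{k<..<N} \<inter> same = same" by (auto simp: same_def)
  also have "{k<..<N} \<inter> outer k = outer k" by (auto simp: outer_def)
  also have "2 * card same + card (outer k) < 2 * t"
    using same card_outer[OF assms] mod_less_divisor[of t k] t by linarith
  finally show ?thesis .
qed

text \<open>Each later vertex adds its weight to the load of at most one colour in \<open>Q\<close>,
  so the loads over \<open>Q\<close> sum to less than \<open>2 * t\<close>. Here \<open>c\<close> is
  arbitrary: values at vertices not yet coloured do not enter.\<close>

lemma ex_light_colour:
  assumes "k < N" "finite Q" "card Q = t"
  shows "\<exists>q\<in>Q. load c k q < 2"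
proof (rule ccontr)
  assume "\<not> ?thesis"
  then have "2 * card Q \<le> (\<Sum>q\<in>Q. load c k q)"
    using sum_bounded_below[of Q 2 "load c k"] by (auto simp: not_less)
  also have "\<dots> = (\<Sum>k'\<in>{k<..<N}. \<Sum>q\<in>Q. if c (f k') = q then weight k k' else 0)"
    unfolding load_def by (rule sum.swap)
  also have "\<dots> \<le> (\<Sum>k'\<in>{k<..<N}. weight k k')"
    by (intro sum_mono) (simp add: sum.delta assms(2))
  finally show False using sum_weight[OF assms(1)] assms by simp
qed

text \<open>Two vertices of one block with the same colour would give the earlier one load at least
  2. So a class meets each block at most once, and there are \<open>(N + t - 1) div t\<close>
  blocks.\<close>

lemma light_colouring_class_card:
  assumes c: "light_colouring c"
  shows "card {v. v < N \<and> c v = q} \<le> (N + t - 1) div t"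
proof -
  define K where "K = {k. k < N \<and> c (f k) = q}"
  have "{v. v < N \<and> c v = q} \<subseteq> f ` K"
  proof
    fix v assume v: "v \<in> {v. v < N \<and> c v = q}"
    then have "v \<in> f ` {..<N}" using bij_betw_imp_surj_on[OF peeling_bij] by simp
    then show "v \<in> f ` K" using v by (auto simp: K_def)
  qed
  then have "card {v. v < N \<and> c v = q} \<le> card (f ` K)"
    by (intro card_mono) (auto simp: K_def)
  also have "\<dots> \<le> card K" by (intro card_image_le) (auto simp: K_def)
  finally have le: "card {v. v < N \<and> c v = q} \<le> card K" .
  have "inj_on (\<lambda>k. k div t) K"
  proof (rule linorder_inj_onI)
    fix i j assume ij: "i < j" "i \<in> K" "j \<in> K"
    show "i div t \<noteq> j div t"
    proof
      assume eq: "i div t = j div t"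
      have "(if c (f j) = c (f i) then weight i j else 0) \<le> load c i (c (f i))"
        unfolding load_def using ij by (intro member_le_sum) (auto simp: K_def)
      moreover have "weight i j = 2" "c (f j) = c (f i)" "load c i (c (f i)) < 2"
        using c ij eq by (auto simp: K_def weight_def light_colouring_def)
      ultimately show False by simp
    qed
  qed auto
  then have "card K = card ((\<lambda>k. k div t) ` K)" by (simp add: card_image)
  also have "\<dots> \<le> card {..<(N + t - 1) div t}"
  proof (intro card_mono image_subsetI)
    fix k assume "k \<in> K"
    \<comment> \<open>Adding \<open>t\<close> to \<open>k < N\<close> yields
      \<open>k div t + 1\<close> on the left, hence a strict bound on
      \<open>k div t\<close>.\<close>
    then have "(k + t) div t \<le> (N + t - 1) div t"
      by (intro div_le_mono) (auto simp: K_def)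
    then show "k div t \<in> {..<(N + t - 1) div t}" using t by (simp add: div_add_self2)
  qed simp
  finally show ?thesis using le by simp
qed

text \<open>Each such neighbour weighs at least 1, whether inside or outside the block, and the load
  of the colour is below 2.\<close>

lemma light_colouring_back_degree:
  assumes c: "light_colouring c" and "k < N"
  shows "card {k' \<in> {k<..<N}. c (f k') = c (f k) \<and> adj a b (f k) (f k')} \<le> 1" (is "card ?A \<le> 1")
proof -
  have "card ?A = (\<Sum>k'\<in>?A. 1)" by simp
  also have "\<dots> \<le> (\<Sum>k'\<in>?A. if c (f k') = c (f k) then weight k k' else 0)"
    by (intro sum_mono) (auto simp: weight_def)
  also have "\<dots> \<le> load c k (c (f k))" unfolding load_def by (intro sum_mono2) auto
  finally show ?thesis using c assms(2) by (fastforce simp: light_colouring_def)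
qed

end

end

section \<open>Programs and running times\<close>

text \<open>With a bound in place of the exact time, the branches of a conditional may differ in
  length.\<close>

definition runs :: "prog \<Rightarrow> store \<Rightarrow> nat \<Rightarrow> (store \<Rightarrow> bool) \<Rightarrow> bool" where
  "runs P s T Q \<longleftrightarrow> (\<exists>n s'. exec P s n s' \<and> n \<le> T \<and> Q s')"

lemma runs_mono:
  assumes "runs P s T Q" "T \<le> T'" "\<And>s'. Q s' \<Longrightarrow> Q' s'"
  shows "runs P s T' Q'"
  using assms unfolding runs_def by (meson order_trans)

lemma runs_Seq:
  assumes "runs P s m (\<lambda>s'. runs R s' n Q)"
  shows "runs (Seq P R) s (m + n) Q"
  using assms unfolding runs_def by (blast intro: exec_Seq add_mono)

lemma runs_Seq_le:
  assumes "runs P s m I" "\<And>s'. I s' \<Longrightarrow> runs R s' n Q" "m + n \<le> T"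
  shows "runs (Seq P R) s T Q"
proof (rule runs_mono)
  show "runs (Seq P R) s (m + n) Q"
    by (rule runs_Seq[OF runs_mono[OF assms(1) order_refl assms(2)]])
qed (use assms(3) in auto)

text \<open>The counter \<open>i\<close> belongs to the invariant and need not be a memory cell, so
  loops that count down are covered too. Each round costs one test more than its body, and the final
  test adds one step.\<close>

lemma runs_counting_loop:
  assumes "I i s" "i \<le> m"
    and test: "\<And>i s. I i s \<Longrightarrow> i \<le> m \<Longrightarrow> holds b s \<longleftrightarrow> i < m"
    and body: "\<And>i s. I i s \<Longrightarrow> i < m \<Longrightarrow> runs P s T (I (Suc i))"
    and "Suc ((m - i) * Suc T) \<le> T'"
  shows "runs (While b P) s T' (I m)"
proof -
  have "runs (While b P) s (Suc ((m - i) * Suc T)) (I m)"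
    using assms(1,2)
  proof (induction "m - i" arbitrary: i s)
    case 0
    then have "i = m" "\<not> holds b s" using test by auto
    then show ?case using 0 exec_While_False unfolding runs_def by fastforce
  next
    case (Suc d)
    then have im: "i < m" and d: "d = m - Suc i" by auto
    then have h: "holds b s" using test Suc by auto
    obtain n s' where 1: "exec P s n s'" "n \<le> T" "I (Suc i) s'"
      using body[OF Suc.prems(1) im] unfolding runs_def by blast
    obtain n' s'' where 2: "exec (While b P) s' n' s''" "n' \<le> Suc (d * Suc T)" "I m s''"
      using Suc.hyps(1)[OF d 1(3)] im d unfolding runs_def by auto
    have "exec (While b P) s (Suc (n + n')) s''" using exec_While_True[OF h 1(1) 2(1)] .
    moreover have "Suc (n + n') \<le> Suc ((m - i) * Suc T)"
      using 1(2) 2(2) Suc.hyps(2)[symmetric] by simp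
    ultimately show ?case using 2(3) unfolding runs_def by blast
  qed
  then show ?thesis by (rule runs_mono) (use assms(5) in auto)
qed

text \<open>\<open>effect\<close> and \<open>duration\<close> are meaningful for programs without loops only.\<close>

primrec straight :: "prog \<Rightarrow> bool" where
  "straight Skip \<longleftrightarrow> True"
| "straight (Assign a i e) \<longleftrightarrow> True"
| "straight (Seq P R) \<longleftrightarrow> straight P \<and> straight R"
| "straight (Cond b P R) \<longleftrightarrow> straight P \<and> straight R"
| "straight (While b P) \<longleftrightarrow> False"

primrec effect :: "prog \<Rightarrow> store \<Rightarrow> store" where
  "effect Skip s = s"
| "effect (Assign a i e) s = s(a := (s a)(val i s := val e s))"
| "effect (Seq P R) s = effect R (effect P s)"
| "effect (Cond b P R) s = (if holds b s then effect P s else effect R s)"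
| "effect (While b P) s = s"

primrec duration :: "prog \<Rightarrow> nat" where
  "duration Skip = 1"
| "duration (Assign a i e) = 1"
| "duration (Seq P R) = duration P + duration R"
| "duration (Cond b P R) = Suc (max (duration P) (duration R))"
| "duration (While b P) = 0"

lemma runs_effect: "straight P \<Longrightarrow> runs P s (duration P) (\<lambda>s'. s' = effect P s)"
proof (induction P arbitrary: s)
  case (Seq P R)
  then show ?case by (auto intro!: runs_Seq_le)
next
  case (Cond b P R)
  then have 1: "runs P s (duration P) (\<lambda>s'. s' = effect P s)"
    "runs R s (duration R) (\<lambda>s'. s' = effect R s)" by auto
  then show ?case
    unfolding runs_def
    by (cases "holds b s") (fastforce dest: exec_Cond_True exec_Cond_False)+
qed (auto simp: runs_def intro: exec_Skip exec_Assign)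

text \<open>Reduces claims about loop-free programs to simplification of
  \<open>effect\<close>.\<close>

lemma runs_straight:
  assumes "straight P" "duration P \<le> T" "Q (effect P s)"
  shows "runs P s T Q"
  using runs_mono[OF runs_effect[OF assms(1), of s] assms(2), of Q] assms(3) by simp

text \<open>The frame consists of whole arrays: an array changed in a single cell must be listed in
  \<open>X\<close>, and what survives of it stated separately.\<close>

definition agree :: "nat set \<Rightarrow> store \<Rightarrow> store \<Rightarrow> bool" where
  "agree X s s' \<longleftrightarrow> (\<forall>x. x \<notin> X \<longrightarrow> s' x = s x)"

lemma agree_refl [simp]: "agree X s s"
  by (simp add: agree_def)

abbreviation cell :: "nat \<Rightarrow> expr" where "cell a \<equiv> Get a (Num 0)"

abbreviation set_cell :: "nat \<Rightarrow> expr \<Rightarrow> prog" where "set_cell a e \<equiv> Assign a (Num 0) e"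

abbreviation Disj :: "test \<Rightarrow> test \<Rightarrow> test" where "Disj p q \<equiv> Neg (Conj (Neg p) (Neg q))"

text \<open>The factor \<open>t\<close> is a constant of the program, so the product unrolls into an
  expression of constant size.\<close>

primrec times :: "nat \<Rightarrow> expr \<Rightarrow> expr" where
  "times 0 e = Num 0"
| "times (Suc n) e = Add e (times n e)"

lemma val_times [simp]: "val (times n e) s = n * val e s"
  by (induction n) auto

section \<open>The colouring program\<close>

text \<open>
  Arrays 3, 4 and 5 hold the order of removal, the marks of the removed vertices and the block of
  each position in the order. The others are variables, kept in cell 0: 6 is \<open>b\<close>, 7 is \<open>N\<close>, 8 is
  the current position, 9 is the position in the block and later in the list, 10 is the current block,
  11 is the vertex to be removed, 12 is a loop counter, 13 is the weight of the colour in 14, and 15 is the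
  last colour found to be light.
\<close>

definition size_prog :: prog where
  "size_prog =
     Seq (set_cell 12 (Num 0))
    (Seq (While (Less (cell 12) (Get 0 (Num 1)))
            (Seq (set_cell 6 (Add (cell 6) (Get 0 (Num 2)))) (set_cell 12 (Add (cell 12) (Num 1)))))
    (Seq (set_cell 12 (Num 0))
         (While (Less (cell 12) (Get 0 (Num 0)))
            (Seq (set_cell 7 (Add (cell 7) (cell 6))) (set_cell 12 (Add (cell 12) (Num 1)))))))"

text \<open>A round costs two assignments and a test; the 4 accounts for two initialisations and two
  final tests.\<close>

lemma runs_size_prog:
  assumes "s 6 0 = 0" "s 7 0 = 0" "3 * (s 0 0 + s 0 1) + 4 \<le> T"
  shows "runs size_prog s T (\<lambda>s'. agree {6,7,12} s s' \<and>
           s' 6 0 = s 0 1 * s 0 2 \<and> s' 7 0 = s 0 0 * (s 0 1 * s 0 2))"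
proof -
  define I where "I i s' \<longleftrightarrow> agree {6,12} s s' \<and> s' 12 0 = i \<and> s' 6 0 = i * s 0 2" for i s'
  define J where "J i s' \<longleftrightarrow> agree {6,7,12} s s' \<and> s' 12 0 = i \<and> s' 6 0 = s 0 1 * s 0 2 \<and>
      s' 7 0 = i * (s 0 1 * s 0 2)" for i s'
  have 1: "runs (set_cell 12 (Num 0)) s 1 (I 0)"
    by (rule runs_straight) (auto simp: I_def agree_def assms)
  have 2: "runs (While (Less (cell 12) (Get 0 (Num 1)))
            (Seq (set_cell 6 (Add (cell 6) (Get 0 (Num 2)))) (set_cell 12 (Add (cell 12) (Num 1)))))
          s' (Suc (3 * s 0 1)) (I (s 0 1))" if "I 0 s'" for s'
    using that
    by (rule runs_counting_loop[where I = I and T = 2])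
      (auto simp: I_def agree_def intro!: runs_straight)
  have 3: "runs (set_cell 12 (Num 0)) s' 1 (J 0)" if "I (s 0 1) s'" for s'
    using that assms by (intro runs_straight) (auto simp: I_def J_def agree_def)
  have 4: "runs (While (Less (cell 12) (Get 0 (Num 0)))
            (Seq (set_cell 7 (Add (cell 7) (cell 6))) (set_cell 12 (Add (cell 12) (Num 1)))))
          s' (Suc (3 * s 0 0)) (J (s 0 0))" if "J 0 s'" for s'
    using that
    by (rule runs_counting_loop[where I = J and T = 2])
      (auto simp: J_def agree_def intro!: runs_straight)
  have "runs size_prog s T (J (s 0 0))"
    unfolding size_prog_def
    by (rule runs_Seq_le[OF 1 runs_Seq_le[OF 2 runs_Seq_le[OF 3 4]]]) (use assms(3) in auto)
  then show ?thesis by (rule runs_mono) (auto simp: J_def)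
qed

section \<open>Computing the order of removal\<close>

definition scan_prog :: prog where
  "scan_prog =
     Seq (set_cell 11 (Num 0))
         (While (Less (Num 0) (Get 4 (cell 11))) (set_cell 11 (Add (cell 11) (Num 1))))"

text \<open>The comparison with \<open>N\<close> is made separately, since \<open>marked\<close>
  describes the marks of vertices below \<open>N\<close> only.\<close>

definition choose_prog :: prog where
  "choose_prog =
     (let x = Add (Get 3 (Sub (cell 8) (Num 2))) (Get 0 (Num 2)) in
      Cond (Conj (Equal (cell 9) (Num 2)) (Conj (Less x (cell 7)) (Equal (Get 4 x) (Num 0))))
        (set_cell 11 x) Skip)"

text \<open>Division is not an operation, so \<open>k mod t\<close> and \<open>k div t\<close> are
  kept up to date incrementally, and the block of each position is stored.\<close>

definition record_prog :: "nat \<Rightarrow> prog" where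
  "record_prog t =
     Seq (Assign 4 (cell 11) (Num 1))
    (Seq (Assign 3 (cell 8) (cell 11))
    (Seq (Assign 5 (cell 8) (cell 10))
    (Seq (set_cell 8 (Add (cell 8) (Num 1)))
    (Seq (set_cell 9 (Add (cell 9) (Num 1)))
         (Cond (Equal (cell 9) (Num t))
            (Seq (set_cell 9 (Num 0)) (set_cell 10 (Add (cell 10) (Num 1))))
            Skip)))))"

definition peel_prog :: "nat \<Rightarrow> prog" where
  "peel_prog t =
     While (Less (cell 8) (cell 7)) (Seq scan_prog (Seq choose_prog (record_prog t)))"

definition marked :: "nat \<Rightarrow> nat \<Rightarrow> store \<Rightarrow> bool" where
  "marked N k s \<longleftrightarrow> (\<forall>v<N. s 4 v = 0 \<longleftrightarrow> v \<in> remaining N (s 3) k)"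

text \<open>Array 3 itself plays the part of \<open>f\<close>: the equations below \<open>k\<close>
  are those of \<open>peeling\<close>.\<close>

definition peel_invar :: "nat \<Rightarrow> store \<Rightarrow> nat \<Rightarrow> store \<Rightarrow> bool" where
  "peel_invar t s0 k s \<longleftrightarrow>
     agree {3,4,5,8,9,10,11} s0 s \<and> s 8 0 = k \<and> s 9 0 = k mod t \<and> s 10 0 = k div t \<and>
     (\<forall>i<k. s 3 i = peel_step (s0 7 0) (s0 0 2) t (s 3) i) \<and> (\<forall>i<k. s 5 i = i div t) \<and>
     marked (s0 7 0) k s"

lemma runs_scan_prog:
  assumes "marked N k s" "k < N"
  shows "runs scan_prog s (2 * N + 2)
           (\<lambda>s'. agree {11} s s' \<and> s' 11 0 = Min (remaining N (s 3) k))"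
proof -
  define m where "m = Min (remaining N (s 3) k)"
  have m: "m \<in> remaining N (s 3) k"
    unfolding m_def using assms by (intro Min_in) (auto simp: remaining_nonempty)
  have lt: "m < N" using m by (simp add: remaining_def)
  \<comment> \<open>Nothing below the minimum remains, so all earlier cells are marked and the scan
    stops exactly at \<open>m\<close>.\<close>
  have mark: "s 4 v = 0 \<longleftrightarrow> v = m" if "v \<le> m" for v
    using assms(1) that m lt Min_le[OF finite_remaining, of v N "s 3" k]
    by (auto simp: marked_def m_def[symmetric])
  define I where "I i s' \<longleftrightarrow> agree {11} s s' \<and> s' 11 0 = i" for i s'
  have 1: "runs (set_cell 11 (Num 0)) s 1 (I 0)"
    by (rule runs_straight) (auto simp: I_def agree_def)
  have 2: "runs (While (Less (Num 0) (Get 4 (cell 11))) (set_cell 11 (Add (cell 11) (Num 1)))) s'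
       (Suc (2 * m)) (I m)" if "I 0 s'" for s'
    using that
  proof (rule runs_counting_loop[where I = I and T = 1])
    fix i s'' assume "I i s''" "i \<le> m"
    then show "holds (Less (Num 0) (Get 4 (cell 11))) s'' \<longleftrightarrow> i < m"
      using mark[of i] by (auto simp: I_def agree_def)
  qed (auto simp: I_def agree_def intro!: runs_straight)
  have "runs scan_prog s (2 * N + 2) (I m)"
    unfolding scan_prog_def by (rule runs_Seq_le[OF 1 2]) (use lt in auto)
  then show ?thesis by (rule runs_mono) (auto simp: I_def m_def)
qed

lemma runs_choose_prog:
  assumes "marked N k s" "k < N" "s 7 0 = N" "s 8 0 = k" "s 9 0 = k mod t"
    "s 11 0 = Min (remaining N (s 3) k)"
  shows "runs choose_prog s 2
           (\<lambda>s'. agree {11} s s' \<and> s' 11 0 = peel_step N (s 0 2) t (s 3) k)"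
proof -
  have "v \<in> remaining N (s 3) k \<longleftrightarrow> v < N \<and> s 4 v = 0" for v
    using assms(1) by (auto simp: marked_def remaining_def)
  then show ?thesis
    unfolding choose_prog_def Let_def using assms
    by (intro runs_straight) (auto simp: agree_def peel_step_def)
qed

lemma runs_record_prog:
  assumes "peel_invar t s0 k s1" "agree {11} s1 s" "k < s0 7 0" "t \<ge> 2"
    "s 11 0 = peel_step (s0 7 0) (s0 0 2) t (s 3) k"
  shows "runs (record_prog t) s 8 (peel_invar t s0 (Suc k))"
proof (rule runs_straight)
  let ?N = "s0 7 0" and ?a = "s0 0 2"
  let ?v = "s 11 0" and ?s = "effect (record_prog t) s"
  have s: "agree {3,4,5,8,9,10,11} s0 s" "s 8 0 = k" "s 9 0 = k mod t" "s 10 0 = k div t"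
    "\<forall>i<k. s 3 i = peel_step ?N ?a t (s 3) i" "\<forall>i<k. s 5 i = i div t" "marked ?N k s"
    using assms(1,2) by (auto simp: peel_invar_def agree_def marked_def)
  have v: "?v \<in> remaining ?N (s 3) k" using assms(3,5) peel_step_in_remaining by metis
  have s': "?s 3 = (s 3)(k := ?v)" "?s 4 = (s 4)(?v := 1)" "?s 5 = (s 5)(k := k div t)"
    "?s 8 0 = Suc k" "agree {3,4,5,8,9,10,11} s0 ?s"
    using s by (auto simp: record_prog_def agree_def)
  \<comment> \<open>Writing position \<open>k\<close> affects no equation up to \<open>k\<close>,
    since each refers to strictly earlier positions only.\<close>
  have step: "?s 3 i = peel_step ?N ?a t (?s 3) i" if "i < Suc k" for i
  proof -
    have "peel_step ?N ?a t (?s 3) i = peel_step ?N ?a t (s 3) i"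
      using that assms(4) by (intro peel_step_cong) (auto simp: s')
    then show ?thesis using that s(5) assms(5) by (cases "i = k") (auto simp: s')
  qed
  have "?s 3 ` {..<Suc k} = insert ?v (s 3 ` {..<k})"
    by (auto simp: s' lessThan_Suc)
  then have mark: "marked ?N (Suc k) ?s"
    using s(7) v by (auto simp: marked_def remaining_def s')
  have "?s 9 0 = Suc k mod t \<and> ?s 10 0 = Suc k div t"
    using s(2-4) assms(4) by (auto simp: record_prog_def mod_Suc div_Suc)
  then show "peel_invar t s0 (Suc k) ?s"
    using s' step mark s(6) by (auto simp: peel_invar_def less_Suc_eq)
qed (auto simp: record_prog_def)

lemma runs_peel_prog:
  assumes "t \<ge> 2" "s 8 0 = 0" "s 9 0 = 0" "s 10 0 = 0" "\<forall>v. s 4 v = 0" "s 7 0 = N"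
    and "Suc (N * (13 + 2 * N)) \<le> T"
  shows "runs (peel_prog t) s T (peel_invar t s N)"
  unfolding peel_prog_def
\<comment> \<open>The round takes \<open>2 * N + 2\<close> steps for the scan, 2 for the choice and
  8 for the record.\<close>
proof (rule runs_counting_loop[where I = "peel_invar t s" and T = "2 * N + 12"])
  show "peel_invar t s 0 s"
    using assms by (auto simp: peel_invar_def marked_def remaining_def)
next
  fix k s1 assume inv: "peel_invar t s k s1" and k: "k < N"
  have s1: "marked N k s1" "s1 7 0 = N" "s1 8 0 = k" "s1 9 0 = k mod t" "s1 0 2 = s 0 2"
    using inv assms by (auto simp: peel_invar_def agree_def)
  let ?scanned = "\<lambda>s'. agree {11} s1 s' \<and> s' 11 0 = Min (remaining N (s1 3) k)"
  let ?chosen = "\<lambda>s'. agree {11} s1 s' \<and> s' 11 0 = peel_step N (s 0 2) t (s1 3) k"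
  have chosen: "runs choose_prog s2 2 ?chosen" if s2: "?scanned s2" for s2
  proof (rule runs_mono)
    show "runs choose_prog s2 2
        (\<lambda>s'. agree {11} s2 s' \<and> s' 11 0 = peel_step N (s2 0 2) t (s2 3) k)"
      using s1 s2 k by (intro runs_choose_prog) (auto simp: agree_def marked_def)
  qed (use s1 s2 in \<open>auto simp: agree_def\<close>)
  have recorded: "runs (record_prog t) s3 8 (peel_invar t s (Suc k))" if "?chosen s3" for s3
    using that s1 k assms inv by (intro runs_record_prog[of _ _ _ s1]) (auto simp: agree_def)
  show "runs (Seq scan_prog (Seq choose_prog (record_prog t))) s1 (2 * N + 12)
      (peel_invar t s (Suc k))"
    by (rule runs_Seq_le[OF runs_scan_prog[OF s1(1) k] runs_Seq_le[OF chosen recorded]]) auto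
qed (use assms in \<open>auto simp: peel_invar_def agree_def\<close>)

section \<open>Greedy colouring in the reverse order\<close>

definition adj_test :: test where
  "adj_test =
     (let u = Get 3 (cell 8); v = Get 3 (cell 12); a = Get 0 (Num 2); b = cell 6 in
      Disj (Equal u (Add v (Num 1))) (Disj (Equal v (Add u (Num 1)))
     (Disj (Equal u (Add v a)) (Disj (Equal v (Add u a))
     (Disj (Equal u (Add v b)) (Equal v (Add u b)))))))"

lemma holds_adj_test:
  "holds adj_test s \<longleftrightarrow> adj (s 0 2) (s 6 0) (s 3 (s 8 0)) (s 3 (s 12 0))"
  by (auto simp: adj_test_def adj_def Let_def)

definition load_prog :: prog where
  "load_prog =
     Seq (set_cell 13 (Num 0))
    (Seq (set_cell 12 (Add (cell 8) (Num 1)))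
         (While (Less (cell 12) (cell 7))
            (Seq (Cond (Equal (Get 2 (Get 3 (cell 12))) (cell 14))
                    (Cond (Equal (Get 5 (cell 12)) (Get 5 (cell 8)))
                       (set_cell 13 (Add (cell 13) (Num 2)))
                       (Cond adj_test (set_cell 13 (Add (cell 13) (Num 1))) Skip))
                    Skip)
                 (set_cell 12 (Add (cell 12) (Num 1))))))"

text \<open>All \<open>t\<close> colours are tried and the last light one is kept, so that this is a
  counting loop without early exit.\<close>

definition list_prog :: "nat \<Rightarrow> prog" where
  "list_prog t =
     Seq (set_cell 9 (Num 0))
         (While (Less (cell 9) (Num t))
            (Seq (set_cell 14 (Get 1 (Add (times t (Get 3 (cell 8))) (cell 9))))
            (Seq load_prog
            (Seq (Cond (Less (cell 13) (Num 2)) (set_cell 15 (cell 14)) Skip)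
                 (set_cell 9 (Add (cell 9) (Num 1)))))))"

text \<open>Cell 8 holds \<open>N\<close> when the peeling ends, and counts down from there.\<close>

definition colour_prog :: "nat \<Rightarrow> prog" where
  "colour_prog t =
     While (Less (Num 0) (cell 8))
       (Seq (set_cell 8 (Sub (cell 8) (Num 1)))
       (Seq (list_prog t) (Assign 2 (Get 3 (cell 8)) (cell 15))))"

lemma runs_load_prog:
  assumes "s 7 0 = N" "s 8 0 = k" "k < N" "\<forall>i<N. s 5 i = i div t"
  shows "runs load_prog s (6 * N + 3)
     (\<lambda>s'. agree {12,13} s s' \<and> s' 13 0 = load N (s 0 2) (s 6 0) t (s 3) (s 2) k (s 14 0))"
proof -
  let ?w = "\<lambda>k'. if s 2 (s 3 k') = s 14 0 then weight (s 0 2) (s 6 0) t (s 3) k k' else 0"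
  \<comment> \<open>The condition \<open>k < i\<close> guarantees that extending the interval by one
    adds exactly the summand at \<open>i\<close>.\<close>
  define I where "I i s' \<longleftrightarrow> k < i \<and> agree {12,13} s s' \<and> s' 12 0 = i \<and>
      s' 13 0 = (\<Sum>k'\<in>{k<..<i}. ?w k')" for i s'
  let ?P = "Seq (Cond (Equal (Get 2 (Get 3 (cell 12))) (cell 14))
                    (Cond (Equal (Get 5 (cell 12)) (Get 5 (cell 8)))
                       (set_cell 13 (Add (cell 13) (Num 2)))
                       (Cond adj_test (set_cell 13 (Add (cell 13) (Num 1))) Skip))
                    Skip)
                 (set_cell 12 (Add (cell 12) (Num 1)))"
  have 1: "runs (set_cell 13 (Num 0)) s 1 (\<lambda>s'. agree {12,13} s s' \<and> s' 13 0 = 0)"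
    by (rule runs_straight) (auto simp: agree_def)
  have 2: "runs (set_cell 12 (Add (cell 8) (Num 1))) s' 1 (I (Suc k))"
    if "agree {12,13} s s' \<and> s' 13 0 = 0" for s'
    using that assms by (intro runs_straight) (auto simp: I_def agree_def)
  have body: "runs ?P s' 5 (I (Suc i))" if "I i s'" "i < N" for i s'
  proof (rule runs_straight)
    have "{k<..<Suc i} = insert i {k<..<i}" using that by (auto simp: I_def)
    then have "sum ?w {k<..<Suc i} = ?w i + sum ?w {k<..<i}" by simp
    then show "I (Suc i) (effect ?P s')"
      using that assms
      by (auto simp: I_def agree_def weight_def holds_adj_test simp del: sum.delta sum.delta')
  qed (auto simp: adj_test_def Let_def)
  have 3: "runs (While (Less (cell 12) (cell 7)) ?P) s' (Suc (6 * N)) (I N)" if "I (Suc k) s'" for s'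
    by (rule runs_counting_loop[where I = I and T = 5, OF that _ _ body])
      (use assms in \<open>auto simp: I_def agree_def\<close>)
  have "runs load_prog s (6 * N + 3) (I N)"
    unfolding load_prog_def by (rule runs_Seq_le[OF 1 runs_Seq_le[OF 2 3]]) auto
  then show ?thesis by (rule runs_mono) (auto simp: I_def load_def)
qed

lemma runs_list_prog:
  assumes "s 7 0 = N" "s 8 0 = k" "k < N" "\<forall>i<N. s 5 i = i div t"
    and "Q = (\<lambda>j. s 1 (s 3 k * t + j)) ` {0..<t}"
    and "\<exists>q\<in>Q. load N (s 0 2) (s 6 0) t (s 3) (s 2) k q < 2"
  shows "runs (list_prog t) s (2 + t * (6 * N + 8))
     (\<lambda>s'. agree {9,12,13,14,15} s s' \<and> s' 15 0 \<in> Q \<and>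
           load N (s 0 2) (s 6 0) t (s 3) (s 2) k (s' 15 0) < 2)"
proof -
  let ?q = "\<lambda>j. s 1 (s 3 k * t + j)"
  let ?light = "\<lambda>q. load N (s 0 2) (s 6 0) t (s 3) (s 2) k q < 2"
  \<comment> \<open>Cell 15 may hold a leftover of an earlier vertex, so nothing is claimed about it
    until a light colour has occurred.\<close>
  define I where "I j s' \<longleftrightarrow> agree {9,12,13,14,15} s s' \<and> s' 9 0 = j \<and>
      ((\<exists>i<j. ?light (?q i)) \<longrightarrow> ?light (s' 15 0) \<and> s' 15 0 \<in> ?q ` {0..<j})" for j s'
  let ?get = "set_cell 14 (Get 1 (Add (times t (Get 3 (cell 8))) (cell 9)))"
  let ?save = "Seq (Cond (Less (cell 13) (Num 2)) (set_cell 15 (cell 14)) Skip)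
                 (set_cell 9 (Add (cell 9) (Num 1)))"
  have 1: "runs (set_cell 9 (Num 0)) s 1 (I 0)"
    by (rule runs_straight) (auto simp: I_def agree_def)
  have body: "runs (Seq ?get (Seq load_prog ?save)) s1 (6 * N + 7) (I (Suc j))"
    if s1: "I j s1" and "j < t" for j s1
  proof -
    have a: "runs ?get s1 1 (\<lambda>s2. agree {14} s1 s2 \<and> s2 14 0 = ?q j)"
      using s1 assms by (intro runs_straight) (auto simp: I_def agree_def mult.commute)
    have b: "runs load_prog s2 (6 * N + 3)
        (\<lambda>s3. agree {12,13,14} s1 s3 \<and> s3 14 0 = ?q j \<and>
           s3 13 0 = load N (s 0 2) (s 6 0) t (s 3) (s 2) k (?q j))"
      if s2: "agree {14} s1 s2 \<and> s2 14 0 = ?q j" for s2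
    proof (rule runs_mono)
      show "runs load_prog s2 (6 * N + 3) (\<lambda>s'. agree {12,13} s2 s' \<and>
          s' 13 0 = load N (s2 0 2) (s2 6 0) t (s2 3) (s2 2) k (s2 14 0))"
        using s1 s2 assms by (intro runs_load_prog) (auto simp: I_def agree_def)
    qed (use s1 s2 in \<open>auto simp: I_def agree_def\<close>)
    have c: "runs ?save s3 3 (I (Suc j))"
      if "agree {12,13,14} s1 s3 \<and> s3 14 0 = ?q j \<and>
           s3 13 0 = load N (s 0 2) (s 6 0) t (s 3) (s 2) k (?q j)" for s3
      using that s1
      by (intro runs_straight) (auto simp: I_def agree_def less_Suc_eq)
    show ?thesis by (rule runs_Seq_le[OF a runs_Seq_le[OF b c]]) auto
  qed
  have 2: "runs (While (Less (cell 9) (Num t)) (Seq ?get (Seq load_prog ?save))) s'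
      (1 + t * (6 * N + 8)) (I t)" if "I 0 s'" for s'
    by (rule runs_counting_loop[where I = I and T = "6 * N + 7", OF that _ _ body])
      (auto simp: I_def agree_def)
  have "runs (list_prog t) s (2 + t * (6 * N + 8)) (I t)"
    unfolding list_prog_def by (rule runs_Seq_le[OF 1 2]) auto
  then show ?thesis
    by (rule runs_mono) (use assms in \<open>fastforce simp: I_def\<close>)+
qed

lemma runs_colour_prog:
  assumes t: "t \<ge> 3" and N: "s 7 0 = N" "s 8 0 = N" and blk: "\<forall>i<N. s 5 i = i div t"
    and peel: "peeling N (s 0 2) t (s 3)"
    and lists: "\<And>v. v < N \<Longrightarrow> card ((\<lambda>j. s 1 (v * t + j)) ` {0..<t}) = t"
    and T: "Suc (N * (5 + t * (6 * N + 8))) \<le> T"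
  shows "runs (colour_prog t) s T
     (\<lambda>s'. (\<forall>v<N. s' 2 v \<in> (\<lambda>j. s 1 (v * t + j)) ` {0..<t}) \<and>
           light_colouring N (s 0 2) (s 6 0) t (s 3) (s' 2))"
proof -
  let ?f = "s 3" and ?Q = "\<lambda>v. (\<lambda>j. s 1 (v * t + j)) ` {0..<t}"
  let ?load = "load N (s 0 2) (s 6 0) t (s 3)"
  define ok where "ok c k \<longleftrightarrow> c (?f k) \<in> ?Q (?f k) \<and> ?load c k (c (?f k)) < 2" for c k
  \<comment> \<open>The counter \<open>d\<close> is the number of coloured vertices; it grows while
    the position \<open>N - d\<close> decreases.\<close>
  define I where "I d s' \<longleftrightarrow> agree {2,8,9,12,13,14,15} s s' \<and> s' 8 0 = N - d \<and>
      (\<forall>k\<in>{N - d..<N}. ok (s' 2) k)" for d s'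
  have inj: "inj_on ?f {..<N}" using peeling_inj[OF t peel] .
  have bij: "bij_betw ?f {..<N} {..<N}" using peeling_bij[OF t peel] .
  have body: "runs (Seq (set_cell 8 (Sub (cell 8) (Num 1)))
       (Seq (list_prog t) (Assign 2 (Get 3 (cell 8)) (cell 15)))) s1
      (4 + t * (6 * N + 8)) (I (Suc d))" if s1: "I d s1" and d: "d < N" for d s1
  proof -
    define k where "k = N - Suc d"
    have k: "k < N" "N - d = Suc k" using d by (auto simp: k_def)
    have fk: "?f k < N" using bij_betwE[OF bij] k by simp
    have a: "runs (set_cell 8 (Sub (cell 8) (Num 1))) s1 1
        (\<lambda>s2. agree {8} s1 s2 \<and> s2 8 0 = k)"
      using s1 k by (intro runs_straight) (auto simp: I_def agree_def)
    let ?B = "\<lambda>s3. agree {8,9,12,13,14,15} s1 s3 \<and> s3 8 0 = k \<and>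
          s3 15 0 \<in> ?Q (?f k) \<and> ?load (s1 2) k (s3 15 0) < 2"
    have b: "runs (list_prog t) s2 (2 + t * (6 * N + 8)) ?B"
      if s2: "agree {8} s1 s2 \<and> s2 8 0 = k" for s2
    proof (rule runs_mono)
      have eqs: "s2 7 0 = N" "s2 8 0 = k" "s2 5 = s 5" "s2 1 = s 1" "s2 3 = ?f" "s2 0 = s 0"
        "s2 6 = s 6" "s2 2 = s1 2"
        using s1 s2 N by (auto simp: I_def agree_def)
      have "\<exists>q\<in>?Q (?f k). ?load (s1 2) k q < 2"
        by (rule ex_light_colour[OF t peel k(1) _ lists[OF fk]]) simp
      then show "runs (list_prog t) s2 (2 + t * (6 * N + 8))
        (\<lambda>s'. agree {9,12,13,14,15} s2 s' \<and> s' 15 0 \<in> ?Q (?f k) \<and>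
           load N (s2 0 2) (s2 6 0) t (s2 3) (s2 2) k (s' 15 0) < 2)"
        using eqs k blk by (intro runs_list_prog) auto
    qed (use s1 s2 in \<open>auto simp: I_def agree_def\<close>)
    have c: "runs (Assign 2 (Get 3 (cell 8)) (cell 15)) s3 1 (I (Suc d))" if s3: "?B s3" for s3
    proof (rule runs_straight)
      define s4 where "s4 = effect (Assign 2 (Get 3 (cell 8)) (cell 15)) s3"
      have s': "s4 2 = (s1 2)(?f k := s3 15 0)" "agree {2,8,9,12,13,14,15} s s4" "s4 8 0 = k"
        using s1 s3 by (auto simp: I_def agree_def s4_def)
      \<comment> \<open>The load at \<open>k'\<close> looks at positions after \<open>k'\<close>
        only, and by injectivity none of them holds the vertex just coloured.\<close>
      have load: "?load (s4 2) k' q = ?load (s1 2) k' q" if "k \<le> k'" for k' q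
      proof -
        have "?f i \<noteq> ?f k" if "i \<in> {k'<..<N}" for i
          using inj_onD[OF inj, of i k] that \<open>k \<le> k'\<close> k by auto
        then show ?thesis unfolding load_def by (intro sum.cong) (auto simp: s')
      qed
      have "ok (s4 2) k'" if k': "k' \<in> {k..<N}" for k'
      proof (cases "k' = k")
        case True
        then show ?thesis using s3 load[of k] by (simp add: ok_def s')
      next
        case False
        then have "?f k' \<noteq> ?f k" using inj_onD[OF inj, of k' k] k' by auto
        moreover have "ok (s1 2) k'" using False k' k s1 by (auto simp: I_def)
        ultimately show ?thesis using load[of k'] k' by (simp add: ok_def s')
      qed
      then show "I (Suc d) (effect (Assign 2 (Get 3 (cell 8)) (cell 15)) s3)"
        using s' unfolding s4_def[symmetric] by (simp add: I_def k_def)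
    qed auto
    show ?thesis by (rule runs_Seq_le[OF a runs_Seq_le[OF b c]]) auto
  qed
  have "runs (colour_prog t) s T (I N)"
    unfolding colour_prog_def
    by (rule runs_counting_loop[where I = I and T = "4 + t * (6 * N + 8)", OF _ _ _ body, of 0])
      (use N T in \<open>auto simp: I_def agree_def\<close>)
  then show ?thesis
  proof (rule runs_mono)
    fix s' assume s': "I N s'"
    then have ok: "ok (s' 2) k" if "k < N" for k using that by (auto simp: I_def)
    have "s' 2 v \<in> ?Q v" if "v < N" for v
    proof -
      have "v \<in> ?f ` {..<N}" using that bij_betw_imp_surj_on[OF bij] by simp
      then show ?thesis using ok by (auto simp: ok_def)
    qed
    then show "(\<forall>v<N. s' 2 v \<in> ?Q v) \<and> light_colouring N (s 0 2) (s 6 0) t ?f (s' 2)"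
      using ok by (auto simp: ok_def light_colouring_def)
  qed simp
qed

section \<open>The whole program\<close>

definition grid_colouring_prog :: "nat \<Rightarrow> prog" where
  "grid_colouring_prog t = Seq size_prog (Seq (peel_prog t) (colour_prog t))"

lemma runs_grid_colouring_prog:
  assumes t: "t \<ge> 3" and zero: "\<forall>a\<ge>2. \<forall>i. s a i = 0"
    and N: "N = s 0 0 * (s 0 1 * s 0 2)"
    and lists: "\<And>v. v < N \<Longrightarrow> card ((\<lambda>j. s 1 (v * t + j)) ` {0..<t}) = t"
    and T: "3 * (s 0 0 + s 0 1) + 6 + N * (13 + 2 * N) + N * (5 + t * (6 * N + 8)) \<le> T"
  shows "runs (grid_colouring_prog t) s T
     (\<lambda>s'. (\<forall>v<N. s' 2 v \<in> (\<lambda>j. s 1 (v * t + j)) ` {0..<t}) \<and>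
        (\<exists>f. peeling N (s 0 2) t f \<and>
           light_colouring N (s 0 2) (s 0 1 * s 0 2) t f (s' 2)))"
proof -
  let ?A = "\<lambda>s1. agree {6,7,12} s s1 \<and> s1 6 0 = s 0 1 * s 0 2 \<and> s1 7 0 = N"
  let ?B = "\<lambda>s2. s2 0 = s 0 \<and> s2 1 = s 1 \<and> s2 6 0 = s 0 1 * s 0 2 \<and> s2 7 0 = N \<and> s2 8 0 = N \<and>
      (\<forall>i<N. s2 5 i = i div t) \<and> peeling N (s 0 2) t (s2 3)"
  have 1: "runs size_prog s (3 * (s 0 0 + s 0 1) + 4) ?A"
    unfolding N by (rule runs_size_prog) (use zero in auto)
  have 2: "runs (peel_prog t) s1 (Suc (N * (13 + 2 * N))) ?B" if "?A s1" for s1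
  proof (rule runs_mono)
    show "runs (peel_prog t) s1 (Suc (N * (13 + 2 * N))) (peel_invar t s1 N)"
      using that t zero by (intro runs_peel_prog) (auto simp: agree_def)
  qed (use that in \<open>auto simp: peel_invar_def agree_def peeling_def\<close>)
  have 3: "runs (colour_prog t) s2 (Suc (N * (5 + t * (6 * N + 8))))
     (\<lambda>s'. (\<forall>v<N. s' 2 v \<in> (\<lambda>j. s 1 (v * t + j)) ` {0..<t}) \<and>
        (\<exists>f. peeling N (s 0 2) t f \<and>
           light_colouring N (s 0 2) (s 0 1 * s 0 2) t f (s' 2)))" if s2: "?B s2" for s2
  proof (rule runs_mono)
    show "runs (colour_prog t) s2 (Suc (N * (5 + t * (6 * N + 8))))
     (\<lambda>s'. (\<forall>v<N. s' 2 v \<in> (\<lambda>j. s2 1 (v * t + j)) ` {0..<t}) \<and>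
           light_colouring N (s2 0 2) (s2 6 0) t (s2 3) (s' 2))"
      by (rule runs_colour_prog) (use t s2 lists in auto)
  qed (use s2 in auto)
  show ?thesis
    unfolding grid_colouring_prog_def
    by (rule runs_Seq_le[OF 1 runs_Seq_le[OF 2 3 order_refl]]) (use T in auto)
qed

section \<open>Grids\<close>

text \<open>In any subgraph, the vertex that comes first in the order \<open>pos\<close> has degree at most \<open>k\<close>.\<close>

lemma degenerateI:
  fixes G :: "'a graph" and pos :: "'a \<Rightarrow> nat"
  assumes fin: "finite (verts G)" and inj: "inj_on pos (verts G)"
    and edges: "\<And>e. e \<in> edges G \<Longrightarrow> \<exists>u v. e = {u, v} \<and> u \<noteq> v"
    and later: "\<And>v. v \<in> verts G \<Longrightarrow>
        card {u \<in> verts G. pos v < pos u \<and> {v, u} \<in> edges G} \<le> k"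
  shows "degenerate k G"
  unfolding degenerate_def
proof (intro allI impI)
  fix H assume H: "subgraph H G \<and> verts H \<noteq> {}"
  then have sub: "verts H \<subseteq> verts G" "edges H \<subseteq> edges G" "\<And>e. e \<in> edges H \<Longrightarrow> e \<subseteq> verts H"
    by (auto simp: subgraph_def)
  have finH: "finite (verts H)" using fin sub(1) finite_subset by blast
  obtain v where v: "v \<in> verts H" "\<And>u. u \<in> verts H \<Longrightarrow> pos v \<le> pos u"
    using ex_min_if_finite[of "pos ` verts H"] finH H by (force simp: not_less)
  let ?U = "{u \<in> verts G. pos v < pos u \<and> {v, u} \<in> edges G}"
  \<comment> \<open>As \<open>v\<close> comes first in \<open>H\<close>, every edge of
    \<open>H\<close> at \<open>v\<close> leads to a later vertex.\<close>
  have "{e \<in> edges H. v \<in> e} \<subseteq> (\<lambda>u. {v, u}) ` ?U"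
  proof
    fix e assume e: "e \<in> {e \<in> edges H. v \<in> e}"
    then obtain u where u: "e = {v, u}" "u \<noteq> v" using edges[of e] sub(2) by blast
    then have "u \<in> verts H" using sub(3) e by auto
    moreover have "pos u \<noteq> pos v" using inj_onD[OF inj, of u v] u v sub(1) calculation by auto
    ultimately have "pos v < pos u" using v(2)[of u] by simp
    then show "e \<in> (\<lambda>u. {v, u}) ` ?U" using u e sub(1,2) \<open>u \<in> verts H\<close> by auto
  qed
  then have "vertex_degree H v \<le> card ((\<lambda>u. {v, u}) ` ?U)"
    unfolding vertex_degree_def using fin by (intro card_mono) auto
  also have "\<dots> \<le> card ?U" using fin by (intro card_image_le) auto
  also have "\<dots> \<le> k" using later v(1) sub(1) by auto
  finally have "vertex_degree H v \<le> k" .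
  moreover have "min_degree H \<le> vertex_degree H v"
    unfolding min_degree_def using finH v(1) by (intro Min_le) auto
  ultimately show "min_degree H \<le> k" by simp
qed

section \<open>The numbering of the vertices and the edges\<close>

lemma verts_grid3: "verts (grid3 n1 n2 n3) = ({0..<n1} \<times> {0..<n2}) \<times> {0..<n3}"
  by (simp add: grid3_def cart_prod_def path_graph_def)

lemma card_verts_grid3: "card (verts (grid3 n1 n2 n3)) = n1 * (n2 * n3)"
  by (simp add: verts_grid3 card_cartesian_product)

definition index_vertex :: "nat \<Rightarrow> nat \<Rightarrow> nat \<Rightarrow> vertex3" where
  "index_vertex n2 n3 i = ((i div n3 div n2, i div n3 mod n2), i mod n3)"

lemma index_vertex_index:
  "v \<in> verts (grid3 n1 n2 n3) \<Longrightarrow> index_vertex n2 n3 (vertex_index n2 n3 v) = v"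
  by (auto simp: verts_grid3 index_vertex_def)

text \<open>This covers zero dimensions too, because \<open>i div 0 = 0\<close> and
  \<open>i mod 0 = i\<close>.\<close>

lemma vertex_index_index: "vertex_index n2 n3 (index_vertex n2 n3 i) = i"
  by (simp add: index_vertex_def)

lemma vertex_index_less:
  assumes "v \<in> verts (grid3 n1 n2 n3)"
  shows "vertex_index n2 n3 v < n1 * (n2 * n3)"
proof -
  obtain x y z where v: "v = ((x, y), z)" "x < n1" "y < n2" "z < n3"
    using assms by (auto simp: verts_grid3)
  have "x * n2 + y < n1 * n2"
    using v mult_le_mono1[of "Suc x" n1 n2] by simp
  then have "(x * n2 + y) * n3 + z < n1 * n2 * n3"
    using v mult_le_mono1[of "Suc (x * n2 + y)" "n1 * n2" n3] by simp
  then show ?thesis using v by (simp add: mult.assoc)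
qed

lemma index_vertex_in_verts:
  assumes "i < n1 * (n2 * n3)"
  shows "index_vertex n2 n3 i \<in> verts (grid3 n1 n2 n3)"
proof -
  have pos: "n2 > 0" "n3 > 0" using assms by (auto intro: Nat.gr0I)
  have "i div (n3 * n2) < n1" using assms by (intro less_mult_imp_div_less) (simp add: ac_simps)
  then show ?thesis using pos by (simp add: index_vertex_def verts_grid3 div_mult2_eq)
qed

lemma inj_on_vertex_index: "inj_on (vertex_index n2 n3) (verts (grid3 n1 n2 n3))"
  by (rule inj_on_inverseI[of _ "index_vertex n2 n3"]) (rule index_vertex_index)

lemma edges_path_graph: "{i, j} \<in> edges (path_graph n) \<Longrightarrow> i = Suc j \<or> j = Suc i"
  by (auto simp: path_graph_def doubleton_eq_iff)

lemma edges_cart_prod: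
  assumes "{p, q} \<in> edges (cart_prod G H)"
  shows "fst p = fst q \<and> {snd p, snd q} \<in> edges H \<or> snd p = snd q \<and> {fst p, fst q} \<in> edges G"
  using assms by (auto simp: cart_prod_def doubleton_eq_iff insert_commute)

text \<open>A grid edge changes one coordinate by 1, and the coordinates have place values
  \<open>n2 * n3\<close>, \<open>n3\<close> and 1.\<close>

lemma edges_grid3_adj:
  assumes "{p, q} \<in> edges (grid3 n1 n2 n3)"
  shows "adj n3 (n2 * n3) (vertex_index n2 n3 p) (vertex_index n2 n3 q)"
proof -
  obtain x y z x' y' z' where pq: "p = ((x, y), z)" "q = ((x', y'), z')" by (metis prod.collapse)
  have "x = x' \<and> y = y' \<and> (z = Suc z' \<or> z' = Suc z) \<or>
      x = x' \<and> z = z' \<and> (y = Suc y' \<or> y' = Suc y) \<or>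
      y = y' \<and> z = z' \<and> (x = Suc x' \<or> x' = Suc x)"
    using assms unfolding pq grid3_def
    by (auto dest!: edges_cart_prod edges_path_graph)
  then show ?thesis by (auto simp: pq adj_def algebra_simps)
qed

lemma edges_cart_prod_doubleton: "e \<in> edges (cart_prod G H) \<Longrightarrow> \<exists>p q. e = {p, q}"
  unfolding cart_prod_def by (simp, blast)

lemma edges_grid3_doubleton: "e \<in> edges (grid3 n1 n2 n3) \<Longrightarrow> \<exists>p q. e = {p, q}"
  unfolding grid3_def by (rule edges_cart_prod_doubleton)

section \<open>Transfer to the grid\<close>

lemma div_le_ceiling:
  assumes "t > 0"
  shows "int ((n + t - 1) div t) \<le> \<lceil>real n / real t\<rceil>"
proof -
  define m where "m = nat \<lceil>real n / real t\<rceil>"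
  \<comment> \<open>Since the ceiling is nonnegative, \<open>nat\<close> loses nothing.\<close>
  have "0 \<le> \<lceil>real n / real t\<rceil>" by (rule order_trans[OF _ ceiling_mono[of 0]]) auto
  then have m: "int m = \<lceil>real n / real t\<rceil>" using assms by (simp add: m_def)
  have "real n / real t \<le> real m" using le_of_int_ceiling[of "real n / real t"] m by linarith
  then have "real n \<le> real (m * t)" using assms by (simp add: field_simps)
  then have "n \<le> m * t" by linarith
  then have "n + t - 1 < Suc m * t" using assms by simp
  then have "(n + t - 1) div t \<le> m" using less_mult_imp_div_less less_Suc_eq_le by blast
  then show ?thesis using m by linarith
qed

text \<open>In the order of removal, each vertex has at most one later neighbour of its own colour,
  which is what \<open>degenerateI\<close> asks for with \<open>k = 1\<close>. The class sizes carry
  over because the numbering is injective.\<close>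

lemma light_colouring_grid3:
  fixes n1 n2 n3 :: nat and c :: "nat \<Rightarrow> nat"
  defines "N \<equiv> n1 * (n2 * n3)" and "C \<equiv> \<lambda>v. c (vertex_index n2 n3 v)"
  assumes t: "t \<ge> 3" and pos: "n2 > 0" "n3 > 0"
    and f: "peeling N n3 t f" and c: "light_colouring N n3 (n2 * n3) t f c"
  shows "degenerate 1 (induced (grid3 n1 n2 n3) (colour_class (grid3 n1 n2 n3) C q))"
    and "equitable t (grid3 n1 n2 n3) C"
proof -
  let ?G = "grid3 n1 n2 n3" and ?i = "vertex_index n2 n3"
  define pos where "pos v = inv_into {..<N} f (?i v)" for v
  have bij: "bij_betw f {..<N} {..<N}" using peeling_bij[OF t f] .
  have pos_less: "pos v < N" and f_pos: "f (pos v) = ?i v" if "v \<in> verts ?G" for v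
    using vertex_index_less[OF that] inv_into_into[of "?i v" f "{..<N}"]
      f_inv_into_f[of "?i v" f "{..<N}"] bij_betw_imp_surj_on[OF bij]
    by (auto simp: pos_def N_def)
  have inj_pos: "inj_on pos (verts ?G)"
    using inj_on_vertex_index[of n2 n3 n1] by (metis (no_types, lifting) f_pos inj_on_def)
  let ?H = "\<lambda>q. induced ?G (colour_class ?G C q)"
  have H: "verts (?H q) \<subseteq> verts ?G" "edges (?H q) \<subseteq> edges ?G"
    "v \<in> verts (?H q) \<Longrightarrow> C v = q" for q v
    by (auto simp: induced_def colour_class_def)
  show "degenerate 1 (?H q)"
  proof (rule degenerateI)
    show "finite (verts (?H q))" using finite_subset[OF H(1)] by (simp add: verts_grid3)
    show "inj_on pos (verts (?H q))" using inj_on_subset[OF inj_pos H(1)] .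
    fix e assume "e \<in> edges (?H q)"
    then have e: "e \<in> edges ?G" using H(2) by auto
    then obtain u v where uv: "e = {u, v}" using edges_grid3_doubleton by blast
    \<comment> \<open>No number is adjacent to itself: the differences 1, \<open>n3\<close> and
      \<open>n2 * n3\<close> are positive.\<close>
    then have "u \<noteq> v" using edges_grid3_adj[of u v n1 n2 n3] e \<open>n2 > 0\<close> \<open>n3 > 0\<close>
      by (auto simp: adj_def)
    then show "\<exists>u v. e = {u, v} \<and> u \<noteq> v" using uv by blast
  next
    fix v assume v: "v \<in> verts (?H q)"
    let ?U = "{u \<in> verts (?H q). pos v < pos u \<and> {v, u} \<in> edges (?H q)}"
    let ?K = "{k \<in> {pos v<..<N}. c (f k) = c (f (pos v)) \<and> adj n3 (n2 * n3) (f (pos v)) (f k)}"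
    have vG: "v \<in> verts ?G" using v H(1) by blast
    have "card ?U \<le> card ?K"
    proof (rule card_inj_on_le[of pos])
      show "inj_on pos ?U" using inj_on_subset[OF inj_pos, of ?U] H(1) by blast
      show "pos ` ?U \<subseteq> ?K"
      proof
        fix k assume "k \<in> pos ` ?U"
        then obtain u where u: "k = pos u" "u \<in> verts (?H q)" "pos v < pos u"
          "{v, u} \<in> edges (?H q)" by blast
        have uG: "u \<in> verts ?G" using u H(1) by blast
        have "adj n3 (n2 * n3) (?i v) (?i u)" using edges_grid3_adj[of v u] u(4) H(2) by blast
        then show "k \<in> ?K"
          using u H(3)[OF v] H(3)[OF u(2)] pos_less[OF uG] by (simp add: f_pos[OF uG] f_pos[OF vG] C_def)
      qed
    qed simp
    also have "\<dots> \<le> 1" using light_colouring_back_degree[OF t f c pos_less[OF vG]] .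
    finally show "card ?U \<le> 1" .
  qed
  show "equitable t ?G C"
    unfolding equitable_def
  proof
    fix q
    have "card (colour_class ?G C q) \<le> card {v. v < N \<and> c v = q}"
      using vertex_index_less[of _ n1 n2 n3]
      by (intro card_inj_on_le[of ?i] inj_on_subset[OF inj_on_vertex_index])
        (auto simp: colour_class_def C_def N_def)
    also have "\<dots> \<le> (N + t - 1) div t" by (rule light_colouring_class_card[OF t f c])
    finally have "int (card (colour_class ?G C q)) \<le> int ((N + t - 1) div t)" by simp
    also have "\<dots> \<le> \<lceil>real N / real t\<rceil>" using t by (intro div_le_ceiling) simp
    finally show "int (card (colour_class ?G C q)) \<le> \<lceil>real (card (verts ?G)) / real t\<rceil>"
      by (simp add: card_verts_grid3 N_def)
  qed
qed

section \<open>Correctness and running time\<close>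

lemma grid_colouring_prog_correct:
  fixes n1 n2 n3 :: nat
  defines "N \<equiv> n1 * (n2 * n3)"
  assumes t: "t \<ge> 3" and n: "n1 > 0" "n2 > 0" "n3 > 0"
    and L: "uniform t (grid3 n1 n2 n3) L" and s: "is_input t n1 n2 n3 L s"
  shows "runs (grid_colouring_prog t) s (6 + N * (24 + 8 * t + N * (2 + 6 * t)))
     (\<lambda>s'. list_colouring (degenerate 1) (grid3 n1 n2 n3) L (output_colouring n2 n3 s') \<and>
           equitable t (grid3 n1 n2 n3) (output_colouring n2 n3 s'))"
proof (rule runs_mono)
  let ?G = "grid3 n1 n2 n3" and ?Q = "\<lambda>v. (\<lambda>j. s 1 (v * t + j)) ` {0..<t}"
  have Q: "?Q (vertex_index n2 n3 v) = L v" if "v \<in> verts ?G" for v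
    using s that unfolding is_input_def by blast
  have dims: "s 0 0 = n1" "s 0 1 = n2" "s 0 2 = n3" and zero: "\<forall>a\<ge>2. \<forall>i. s a i = 0"
    using s by (auto simp: is_input_def)
  \<comment> \<open>Every number below \<open>N\<close> belongs to a vertex, whose list has
    \<open>t\<close> elements, so the \<open>t\<close> entries are distinct.\<close>
  have card: "card (?Q i) = t" if "i < N" for i
    using Q[of "index_vertex n2 n3 i"] index_vertex_in_verts[of i n1 n2 n3] that L
    by (simp add: vertex_index_index uniform_def N_def)
  \<comment> \<open>These inequalities absorb \<open>3 * (n1 + n2)\<close> into
    \<open>6 * N\<close>, leaving a polynomial in \<open>N\<close> alone.\<close>
  have le: "n1 \<le> N" "n2 \<le> N" using n by (auto simp: N_def)
  then have "3 * (s 0 0 + s 0 1) + 6 + N * (13 + 2 * N) + N * (5 + t * (6 * N + 8))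
      \<le> 6 + N * (24 + 8 * t + N * (2 + 6 * t))"
    unfolding dims by (simp add: algebra_simps)
  then show "runs (grid_colouring_prog t) s (6 + N * (24 + 8 * t + N * (2 + 6 * t)))
     (\<lambda>s'. (\<forall>v<N. s' 2 v \<in> ?Q v) \<and>
        (\<exists>f. peeling N (s 0 2) t f \<and> light_colouring N (s 0 2) (s 0 1 * s 0 2) t f (s' 2)))"
    by (intro runs_grid_colouring_prog t zero card) (simp_all only: dims N_def)
  fix s' :: store assume s': "(\<forall>v<N. s' 2 v \<in> ?Q v) \<and>
        (\<exists>f. peeling N (s 0 2) t f \<and> light_colouring N (s 0 2) (s 0 1 * s 0 2) t f (s' 2))"
  then obtain f where f: "peeling N n3 t f" "light_colouring N n3 (n2 * n3) t f (s' 2)"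
    unfolding dims by blast
  have out: "output_colouring n2 n3 s' = (\<lambda>v. s' 2 (vertex_index n2 n3 v))"
    by (simp add: fun_eq_iff output_colouring_def)
  have "output_colouring n2 n3 s' v \<in> L v" if "v \<in> verts ?G" for v
  proof -
    have "vertex_index n2 n3 v < N" using vertex_index_less[OF that] by (simp only: N_def)
    then have "s' 2 (vertex_index n2 n3 v) \<in> ?Q (vertex_index n2 n3 v)" using s' by blast
    then show ?thesis unfolding out Q[OF that] .
  qed
  then show "list_colouring (degenerate 1) ?G L (output_colouring n2 n3 s') \<and>
      equitable t ?G (output_colouring n2 n3 s')"
    using light_colouring_grid3[OF t n(2,3) f[unfolded N_def]]
    unfolding list_colouring_def out by blast
qed simp

text \<open>With this, choosability follows by running the program on some encoding of
  \<open>L\<close>.\<close>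

lemma ex_input:
  assumes "uniform t (grid3 n1 n2 n3) L" "t > 0"
  shows "\<exists>s. is_input t n1 n2 n3 L s"
proof -
  let ?G = "grid3 n1 n2 n3"
  have "\<forall>v\<in>verts ?G. \<exists>h. h ` {0..<t} = L v"
    using assms(1) ex_bij_betw_nat_finite unfolding uniform_def bij_betw_def by metis
  then obtain h where h: "\<And>v. v \<in> verts ?G \<Longrightarrow> h v ` {0..<t} = L v" by metis
  define s :: store where
    "s a i = (if a = 0 then (if i = 0 then n1 else if i = 1 then n2 else if i = 2 then n3 else 0)
       else if a = 1 \<and> i < n1 * (n2 * n3) * t
         then h (index_vertex n2 n3 (i div t)) (i mod t) else 0)" for a i
  have "(\<lambda>j. s 1 (vertex_index n2 n3 v * t + j)) ` {0..<t} = L v" if v: "v \<in> verts ?G" for v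
  proof -
    have "s 1 (vertex_index n2 n3 v * t + j) = h v j" if "j < t" for j
    proof -
      have "Suc (vertex_index n2 n3 v) * t \<le> n1 * (n2 * n3) * t"
        using vertex_index_less[OF v] by (intro mult_le_mono1) simp
      then have "vertex_index n2 n3 v * t + j < n1 * (n2 * n3) * t" using that by simp
      then show ?thesis using that index_vertex_index[OF v] by (simp add: s_def)
    qed
    then show ?thesis using h[OF v] by auto
  qed
  then have "is_input t n1 n2 n3 L s"
    by (auto simp: is_input_def s_def card_verts_grid3)
  then show ?thesis by blast
qed

theorem theorem3:
  fixes t :: nat
  assumes "t \<ge> 3"
  shows "(\<forall>n1 n2 n3. n1 \<ge> 2 \<and> n2 \<ge> 2 \<and> n3 \<ge> 2 \<longrightarrow>
            equitably_choosable t (degenerate 1) (grid3 n1 n2 n3)) \<and>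
         (\<exists>(P :: prog) (p :: nat poly). \<forall>n1 n2 n3 L s.
            n1 \<ge> 2 \<and> n2 \<ge> 2 \<and> n3 \<ge> 2 \<and>
            list_assignment (grid3 n1 n2 n3) L \<and> uniform t (grid3 n1 n2 n3) L \<and>
            is_input t n1 n2 n3 L s \<longrightarrow>
            (\<exists>time s'. exec P s time s' \<and>
               time \<le> poly p (card (verts (grid3 n1 n2 n3))) \<and>
               list_colouring (degenerate 1) (grid3 n1 n2 n3) L (output_colouring n2 n3 s') \<and>
               equitable t (grid3 n1 n2 n3) (output_colouring n2 n3 s')))"
proof -
  \<comment> \<open>The coefficients of the time bound, from the constant term up; \<open>t\<close>
    is fixed and may occur in them.\<close>
  let ?P = "grid_colouring_prog t" and ?p = "[:6, 24 + 8 * t, 2 + 6 * t:]"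
  have main: "\<exists>time s'. exec ?P s time s' \<and> time \<le> poly ?p (card (verts (grid3 n1 n2 n3))) \<and>
      list_colouring (degenerate 1) (grid3 n1 n2 n3) L (output_colouring n2 n3 s') \<and>
      equitable t (grid3 n1 n2 n3) (output_colouring n2 n3 s')"
    if "n1 \<ge> 2" "n2 \<ge> 2" "n3 \<ge> 2" "uniform t (grid3 n1 n2 n3) L" "is_input t n1 n2 n3 L s"
    for n1 n2 n3 L s
    using grid_colouring_prog_correct[OF assms _ _ _ that(4,5)] that(1-3)
    unfolding runs_def card_verts_grid3 by simp
  have "equitably_choosable t (degenerate 1) (grid3 n1 n2 n3)"
    if "n1 \<ge> 2" "n2 \<ge> 2" "n3 \<ge> 2" for n1 n2 n3
    unfolding equitably_choosable_def
  proof (intro allI impI)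
    fix L assume L: "list_assignment (grid3 n1 n2 n3) L \<and> uniform t (grid3 n1 n2 n3) L"
    then obtain s where "is_input t n1 n2 n3 L s" using ex_input assms by force
    then show "\<exists>c. list_colouring (degenerate 1) (grid3 n1 n2 n3) L c \<and>
        equitable t (grid3 n1 n2 n3) c"
      using main that L by blast
  qed
  then show ?thesis using main by blast
qed

end
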